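(* Let $b\in\mathbb{N}$, let $t=t(n)$ be an integer sequence with $t=b\log(n)+o(\log(n))$, and let $L=\lceil a\log(n)\rceil+\lfloor t/3\rfloor+1$ where $a>\max\{b/3+1,\,2b/3\}$ is a fixed real number. Then $$\lim_{n\to\infty}\frac{\log(D_n(L,t))}{n}=1.$$
   Context: All logarithms are base 2. $\Sigma=\{0,1\}$, $[i]=\{1,\dots,i\}$. For $\mathbf{x}\in\Sigma^n$, $\mathbf{x}_{i,k}=(x_i,\dots,x_{i+k-1})$ is the length-$k$ substring starting at position $i$. A string is $\ell$-substring unique if all its length-$\ell$ substrings (at different positions) are pairwise distinct. Put $\ell_1=L-\lfloor t/3\rfloor-1$, $\ell_2=L-\lceil 2t/3\rceil-1$, $\ell_3=L-t-1$, $I_2=\{n-\ell_2-t+1,\dots,n-\ell_2+1\}$, $I_3=\{n-\ell_3-t+1,\dots,n-\ell_3+1\}$. A string $\mathbf{x}\in\Sigma^n$ satisfies the $(n,L,t)$-lossy reconstruction (LREC) constraints if: (1) $\mathbf{x}$ is $\ell_1$-substring unique; (2) for all $i\in[t+1]$, $j\in[n-\ell_2+1]$ with $i\ne j$, $\mathbf{x}_{i,\ell_2}\ne\mathbf{x}_{j,\ell_2}$; and for all $i\in[n-\ell_2+1]$, $j\in I_2$ with $i\neq j$, $\mathbf{x}_{i,\ell_2}\ne\mathbf{x}_{j,\ell_2}$; (3) for all $i\in[t+1]$, $j\in I_3$, $\mathbf{x}_{i,\ell_3}\ne\mathbf{x}_{j,\ell_3}$. $\mathcal{D}_n(L,t)$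 is the set of all $\mathbf{x}\in\Sigma^n$ satisfying these constraints and $D_n(L,t)=|\mathcal{D}_n(L,t)|$. *)

theory Defs
  imports Complex_Main "HOL-Library.Landau_Symbols"
begin

text \<open>
  Binary strings are boolean lists. Positions are 1-based as on paper, and positions and lengths
  are integers, so that the differences below never truncate.
\<close>

definition substring :: "bool list \<Rightarrow> int \<Rightarrow> int \<Rightarrow> bool list" where
  "substring x i k = take (nat k) (drop (nat (i - 1)) x)"

definition substring_unique :: "int \<Rightarrow> bool list \<Rightarrow> bool" where
  "substring_unique l x \<longleftrightarrow>
     (\<forall>i\<in>{1..int (length x) - l + 1}. \<forall>j\<in>{1..int (length x) - l + 1}.
        i \<noteq> j \<longrightarrow> substring x i l \<noteq> substring x j l)"

definition ell1 :: "int \<Rightarrow> int \<Rightarrow> int" where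
  "ell1 L t = L - \<lfloor>real_of_int t / 3\<rfloor> - 1"

definition ell2 :: "int \<Rightarrow> int \<Rightarrow> int" where
  "ell2 L t = L - \<lceil>2 * real_of_int t / 3\<rceil> - 1"

definition ell3 :: "int \<Rightarrow> int \<Rightarrow> int" where
  "ell3 L t = L - t - 1"

definition I2 :: "nat \<Rightarrow> int \<Rightarrow> int \<Rightarrow> int set" where
  "I2 n L t = {int n - ell2 L t - t + 1 .. int n - ell2 L t + 1}"

definition I3 :: "nat \<Rightarrow> int \<Rightarrow> int \<Rightarrow> int set" where
  "I3 n L t = {int n - ell3 L t - t + 1 .. int n - ell3 L t + 1}"

text \<open>The lossy reconstruction constraints, for a string of length \<open>n\<close>.\<close>

definition LREC :: "nat \<Rightarrow> int \<Rightarrow> int \<Rightarrow> bool list \<Rightarrow> bool" where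
  "LREC n L t x \<longleftrightarrow>
     substring_unique (ell1 L t) x \<and>
     (\<forall>i\<in>{1..t + 1}. \<forall>j\<in>{1..int n - ell2 L t + 1}.
        i \<noteq> j \<longrightarrow> substring x i (ell2 L t) \<noteq> substring x j (ell2 L t)) \<and>
     (\<forall>i\<in>{1..int n - ell2 L t + 1}. \<forall>j\<in>I2 n L t.
        i \<noteq> j \<longrightarrow> substring x i (ell2 L t) \<noteq> substring x j (ell2 L t)) \<and>
     (\<forall>i\<in>{1..t + 1}. \<forall>j\<in>I3 n L t.
        substring x i (ell3 L t) \<noteq> substring x j (ell3 L t))"

definition LREC_set :: "nat \<Rightarrow> int \<Rightarrow> int \<Rightarrow> bool list set" where
  "LREC_set n L t = {x. length x = n \<and> LREC n L t x}"

definition D :: "nat \<Rightarrow> int \<Rightarrow> int \<Rightarrow> nat" where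
  "D n L t = card (LREC_set n L t)"

end

theory Submission
  imports Defs "HOL-Real_Asymp.Real_Asymp"
begin

text \<open>
  Strings are built letter by letter. Let \<open>S k\<close> be the number of strings of length \<open>k\<close>
  satisfying all constraints that lie inside the string. If appending a letter to such a string
  creates a repetition of length \<open>l\<close> ending at the new letter, then the new string is determined by
  its first \<open>k + 1 - l\<close> letters, even when the two occurrences overlap, and these again satisfy
  the constraints. Hence \<open>S (k + 1) \<ge> 2 S k - (\<Sum> S (k + 1 - l))\<close>, the sum ranging over the
  constraints ending at \<open>k + 1\<close>, and \<open>S (k + 1) \<ge> \<beta> S k\<close> follows by induction once
  \<open>\<Sum> 1 / \<beta> ^ (l - 1) \<le> 2 - \<beta>\<close>. Here there are at most \<open>n\<close> such constraints with
  \<open>l \<ge> (1 + \<eta>) log n\<close> and \<open>t + 1 = O(log n)\<close> with \<open>l \<ge> \<eta> log n\<close>, so every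
  \<open>\<beta> < 2\<close> close to \<open>2\<close> is admissible for large \<open>n\<close>.
\<close>

section \<open>Counting strings that avoid prescribed repetitions\<close>

text \<open>A triple \<open>(i, j, l)\<close> forbids equal substrings of length \<open>l\<close> at the 0-based positions
  \<open>i\<close> and \<open>j\<close>.\<close>

definition avoiding :: "(nat \<times> nat \<times> nat) set \<Rightarrow> nat \<Rightarrow> bool list set" where
  "avoiding C k = {x. length x = k \<and>
     (\<forall>(i, j, l)\<in>C. j + l \<le> k \<longrightarrow> take l (drop i x) \<noteq> take l (drop j x))}"

lemma finite_avoiding [simp]: "finite (avoiding C k)"
  by (rule finite_subset[OF _ finite_lists_length_eq[of UNIV k]]) (auto simp: avoiding_def)

lemma take_in_avoiding:
  assumes "x \<in> avoiding C k" "j \<le> k" "\<And>i j l. (i, j, l) \<in> C \<Longrightarrow> i < j"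
  shows "take j x \<in> avoiding C j"
proof -
  have "take l (drop i (take j x)) \<noteq> take l (drop j' (take j x))"
    if "(i, j', l) \<in> C" "j' + l \<le> j" for i j' l
  proof -
    have "i < j'" using assms(3) that by blast
    then have "take l (drop i (take j x)) = take l (drop i x)"
      "take l (drop j' (take j x)) = take l (drop j' x)"
      using that by (simp_all add: drop_take)
    moreover have "take l (drop i x) \<noteq> take l (drop j' x)"
      using assms(1,2) that by (fastforce simp: avoiding_def)
    ultimately show ?thesis by simp
  qed
  then show ?thesis
    using assms by (auto simp: avoiding_def)
qed

text \<open>The repeat copies the letter at \<open>i + q\<close> to \<open>j + q\<close>, so the
  first \<open>j\<close> letters fix the rest. Hence \<open>take j\<close> is injective on strings
  with a given repeat at the end.\<close>

lemma eq_if_repeat_at_end: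
  fixes x y :: "'a list"
  assumes "i < j" "length x = j + l" "length y = j + l" "take j x = take j y"
    and x: "take l (drop i x) = take l (drop j x)"
    and y: "take l (drop i y) = take l (drop j y)"
  shows "x = y"
proof (rule nth_equalityI)
  show "length x = length y" using assms by simp
next
  fix p assume "p < length x"
  then show "x ! p = y ! p"
  proof (induction p rule: less_induct)
    case (less p)
    show ?case
    proof (cases "p < j")
      case True
      then show ?thesis using assms(4) by (metis nth_take)
    next
      case False
      define q where "q = p - j"
      have q: "p = j + q" "q < l" using False less.prems assms(2) by (auto simp: q_def)
      have per: "z ! (i + q) = z ! p"
        if "take l (drop i z) = take l (drop j z)" "length z = j + l" for z :: "'a list"
        using arg_cong[OF that(1), of "\<lambda>w. w ! q"] q that(2) assms(1) by simp
      \<comment> \<open>The source \<open>i + q\<close> precedes \<open>p\<close>, but it may itself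
        be at least \<open>j\<close> when the occurrences overlap; hence the strong
        induction.\<close>
      have "x ! (i + q) = y ! (i + q)"
        using less.IH[of "i + q"] q assms(1,2) by simp
      then show ?thesis using per[OF x] per[OF y] assms(2,3) by simp
    qed
  qed
qed

text \<open>A union bound over the triples that first become active at length \<open>Suc k\<close>,
  each of which spoils at most \<open>card (avoiding C j)\<close> of the one-letter
  extensions.\<close>

lemma avoiding_step:
  assumes "finite C" and C: "\<And>i j l. (i, j, l) \<in> C \<Longrightarrow> i < j \<and> 0 < l"
  shows "2 * card (avoiding C k) \<le> card (avoiding C (Suc k)) +
     (\<Sum>(i, j, l)\<in>{(i, j, l)\<in>C. j + l = Suc k}. card (avoiding C j))"
proof -
  define F where "F = {(i, j, l)\<in>C. j + l = Suc k}"
  have finF: "finite F" by (rule finite_subset[OF _ assms(1)]) (auto simp: F_def)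
  define X where "X = (\<lambda>(x, c :: bool). x @ [c]) ` (avoiding C k \<times> UNIV)"
  have cX: "card X = 2 * card (avoiding C k)"
    unfolding X_def by (subst card_image) (auto simp: inj_on_def card_cartesian_product)
  have finX: "finite X" by (simp add: X_def)
  have X: "length x = Suc k" "take k x \<in> avoiding C k" if "x \<in> X" for x
    using that by (auto simp: X_def avoiding_def)
  define B where "B = (\<lambda>(i, j, l). {x \<in> X. take l (drop i x) = take l (drop j x)})"
  have cB: "card (B (i, j, l)) \<le> card (avoiding C j)" if "(i, j, l) \<in> F" for i j l
  proof (rule card_inj_on_le)
    have ij: "i < j" "0 < l" "j + l = Suc k" using that C by (auto simp: F_def)
    show "inj_on (take j) (B (i, j, l))"
      using eq_if_repeat_at_end[of i j _ l] ij X(1) by (auto simp: inj_on_def B_def)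
    show "take j ` B (i, j, l) \<subseteq> avoiding C j"
    proof clarify
      fix x assume "x \<in> B (i, j, l)"
      then have "take j (take k x) \<in> avoiding C j"
        using ij C by (intro take_in_avoiding[of _ C k] X(2)) (auto simp: B_def)
      then show "take j x \<in> avoiding C j" using ij by (simp add: min_def)
    qed
  qed simp
  have "X \<subseteq> avoiding C (Suc k) \<union> (\<Union>c\<in>F. B c)"
  proof
    fix x assume x: "x \<in> X"
    show "x \<in> avoiding C (Suc k) \<union> (\<Union>c\<in>F. B c)"
    proof (rule ccontr)
      assume neg: "x \<notin> avoiding C (Suc k) \<union> (\<Union>c\<in>F. B c)"
      then obtain i j l where ijl: "(i, j, l) \<in> C" "j + l \<le> Suc k"
        "take l (drop i x) = take l (drop j x)"
        using X(1)[OF x] by (auto simp: avoiding_def)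
      show False
      proof (cases "j + l = Suc k")
        case True
        then have "(i, j, l) \<in> F" "x \<in> B (i, j, l)" using ijl x by (auto simp: F_def B_def)
        then show False using neg by blast
      next
        case False
        \<comment> \<open>Both occurrences lie in the first \<open>k\<close> letters, so
          \<open>take k x\<close> would already violate the triple.\<close>
        then have le: "j + l \<le> k" "i < j" using ijl C by auto
        then have "take l (drop i (take k x)) = take l (drop j (take k x))"
          using ijl(3) by (simp add: drop_take min_def)
        then show False using X(2)[OF x] ijl(1) le by (fastforce simp: avoiding_def)
      qed
    qed
  qed
  then have "card X \<le> card (avoiding C (Suc k) \<union> (\<Union>c\<in>F. B c))"
    by (rule card_mono[rotated]) (use finX finF in \<open>auto simp: B_def\<close>)
  also have "\<dots> \<le> card (avoiding C (Suc k)) + card (\<Union>c\<in>F. B c)"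
    by (rule card_Un_le)
  also have "card (\<Union>c\<in>F. B c) \<le> (\<Sum>c\<in>F. card (B c))"
    by (rule card_UN_le[OF finF])
  also have "\<dots> \<le> (\<Sum>(i, j, l)\<in>F. card (avoiding C j))"
    using cB by (intro sum_mono) auto
  finally show ?thesis using cX by (simp add: F_def)
qed

text \<open>The growth already proved for shorter strings bounds each subtracted count by a fraction
  of the count at length \<open>k\<close>; the weight condition caps the total loss at the fraction
  \<open>2 - \<beta>\<close>.\<close>

lemma avoiding_growth:
  fixes \<beta> :: real
  assumes "finite C" and C: "\<And>i j l. (i, j, l) \<in> C \<Longrightarrow> i < j \<and> 0 < l"
    and "\<beta> > 0"
    and wt: "\<And>k. (\<Sum>(i, j, l)\<in>{(i, j, l)\<in>C. j + l = Suc k}. 1 / \<beta> ^ (l - 1)) \<le> 2 - \<beta>"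
  shows "\<beta> ^ k \<le> real (card (avoiding C k))"
proof -
  let ?S = "\<lambda>k. real (card (avoiding C k))"
  have step: "\<beta> * ?S k \<le> ?S (Suc k)" for k
  proof (induction k rule: less_induct)
    case (less k)
    have geom: "?S j * \<beta> ^ d \<le> ?S (j + d)" if "j + d \<le> k" for j d
      using that
    proof (induction d)
      case (Suc d)
      have "?S j * \<beta> ^ Suc d \<le> \<beta> * ?S (j + d)"
        using Suc \<open>\<beta> > 0\<close> by (simp add: algebra_simps)
      also have "\<dots> \<le> ?S (j + Suc d)" using less[of "j + d"] Suc.prems by simp
      finally show ?case .
    qed simp
    let ?F = "{(i, j, l)\<in>C. j + l = Suc k}"
    have "2 * ?S k \<le> ?S (Suc k) + (\<Sum>(i, j, l)\<in>?F. ?S j)"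
      using of_nat_mono[OF avoiding_step[of C k, OF assms(1) C], where 'a = real]
      by (simp add: case_prod_unfold)
    \<comment> \<open>The exponent is \<open>l - 1\<close> because the comparison is with length
      \<open>k\<close>, not \<open>Suc k\<close>.\<close>
    also have "(\<Sum>(i, j, l)\<in>?F. ?S j) \<le> (\<Sum>(i, j, l)\<in>?F. ?S k * (1 / \<beta> ^ (l - 1)))"
    proof (rule sum_mono, clarify)
      fix i j l assume "(i, j, l) \<in> C" "j + l = Suc k"
      then have "j + (l - 1) = k" using C by fastforce
      then show "?S j \<le> ?S k * (1 / \<beta> ^ (l - 1))"
        using geom[of j "l - 1"] \<open>\<beta> > 0\<close> by (simp add: field_simps)
    qed
    also have "\<dots> = ?S k * (\<Sum>(i, j, l)\<in>?F. 1 / \<beta> ^ (l - 1))"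
      by (simp add: sum_distrib_left case_prod_unfold)
    also have "\<dots> \<le> ?S k * (2 - \<beta>)" by (intro mult_left_mono wt) simp
    finally show ?case by (simp add: algebra_simps)
  qed
  show ?thesis
  proof (induction k)
    case 0
    \<comment> \<open>Every \<open>l\<close> is positive, so no triple is active at length
      0.\<close>
    have "avoiding C 0 = {[]}" using C by (fastforce simp: avoiding_def)
    then show ?case by simp
  next
    case (Suc k)
    have "\<beta> ^ Suc k \<le> \<beta> * ?S k" using Suc \<open>\<beta> > 0\<close> by simp
    then show ?case using step[of k] by linarith
  qed
qed

section \<open>Two families of forbidden repetitions\<close>

lemma repeat_free_count:
  fixes \<beta> :: real
  assumes "0 < m" "0 < r" "\<beta> > 0"
    and wt: "real n / \<beta> ^ (m - 1) + real T / \<beta> ^ (r - 1) \<le> 2 - \<beta>"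
  shows "\<beta> ^ n \<le> real (card {x :: bool list. length x = n \<and>
    (\<forall>i j. i < j \<and> j + m \<le> n \<longrightarrow> take m (drop i x) \<noteq> take m (drop j x)) \<and>
    (\<forall>i j. i < j \<and> i < T \<and> j + r \<le> n \<longrightarrow> take r (drop i x) \<noteq> take r (drop j x))})"
proof -
  define C where "C = {(i, j, l). l = m \<and> i < j \<and> j + m \<le> n} \<union>
    {(i, j, l). l = r \<and> i < j \<and> i < T \<and> j + r \<le> n}"
  have "C \<subseteq> {..n} \<times> {..n} \<times> {m, r}" by (auto simp: C_def)
  then have finC: "finite C" by (rule finite_subset) simp
  have C: "i < j \<and> 0 < l" if "(i, j, l) \<in> C" for i j l using that assms by (auto simp: C_def)
  have "(\<Sum>(i, j, l)\<in>{(i, j, l)\<in>C. j + l = Suc k}. 1 / \<beta> ^ (l - 1)) \<le> 2 - \<beta>" for k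
  proof -
    let ?f = "\<lambda>(i :: nat, j :: nat, l). 1 / \<beta> ^ (l - 1)"
    \<comment> \<open>The end \<open>Suc k\<close> and the length determine \<open>j\<close>, so
      only \<open>i\<close> varies: at most \<open>n\<close> values for length \<open>m\<close> and
      \<open>T\<close> for length \<open>r\<close>. The two images may overlap if
      \<open>m = r\<close>, which is harmless for an upper bound.\<close>
    let ?M = "(\<lambda>i. (i, Suc k - m, m)) ` {..<n}" and ?R = "(\<lambda>i. (i, Suc k - r, r)) ` {..<T}"
    have "sum ?f {(i, j, l)\<in>C. j + l = Suc k} \<le> sum ?f (?M \<union> ?R)"
    proof (rule sum_mono2)
      show "{(i, j, l)\<in>C. j + l = Suc k} \<subseteq> ?M \<union> ?R"
      proof clarify
        fix i j l assume *: "(i, j, l) \<in> C" "j + l = Suc k" "(i, j, l) \<notin> ?R"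
        then have "j = Suc k - l" by simp
        with * show "(i, j, l) \<in> ?M" by (auto simp: C_def)
      qed
    qed (use \<open>\<beta> > 0\<close> in auto)
    also have "\<dots> \<le> sum ?f ?M + sum ?f ?R"
      by (subst sum_Un) (auto intro!: sum_nonneg simp: \<open>\<beta> > 0\<close> less_imp_le)
    also have "sum ?f ?M = real n / \<beta> ^ (m - 1)"
      by (subst sum.reindex) (auto simp: inj_on_def)
    also have "sum ?f ?R = real T / \<beta> ^ (r - 1)"
      by (subst sum.reindex) (auto simp: inj_on_def)
    finally show ?thesis using wt by simp
  qed
  from avoiding_growth[OF finC C \<open>\<beta> > 0\<close> this, of n]
  have "\<beta> ^ n \<le> real (card (avoiding C n))" .
  also have "avoiding C n = {x :: bool list. length x = n \<and>
    (\<forall>i j. i < j \<and> j + m \<le> n \<longrightarrow> take m (drop i x) \<noteq> take m (drop j x)) \<and>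
    (\<forall>i j. i < j \<and> i < T \<and> j + r \<le> n \<longrightarrow> take r (drop i x) \<noteq> take r (drop j x))}"
    unfolding avoiding_def C_def by blast
  finally show ?thesis .
qed

section \<open>Lower bound for the LREC count\<close>

text \<open>Constraint (2) is strengthened to full \<open>ell2\<close>-substring uniqueness, which costs nothing
  asymptotically; together with (1) it follows from uniqueness at the smaller of the two lengths.\<close>

lemma LREC_if_repeat_free:
  assumes pos: "0 < m" "int m \<le> ell1 L t" "int m \<le> ell2 L t" "0 < ell3 L t"
    and sep: "ell3 L t + 2 * t < int n" "ell2 L t + t \<le> int n"
    and len: "length x = n"
    and rm: "\<And>i j. i < j \<Longrightarrow> j + m \<le> n \<Longrightarrow> take m (drop i x) \<noteq> take m (drop j x)"
    and rr: "\<And>i j. i < j \<Longrightarrow> i < nat (t + 1) \<Longrightarrow> j + nat (ell3 L t) \<le> n \<Longrightarrow>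
      take (nat (ell3 L t)) (drop i x) \<noteq> take (nat (ell3 L t)) (drop j x)"
  shows "LREC n L t x"
proof -
  \<comment> \<open>Equal substrings of length \<open>l\<close> have equal prefixes of length
    \<open>m\<close>, as \<open>m\<close> is at most \<open>l\<close>.\<close>
  have less: "substring x i l \<noteq> substring x j l"
    if "int m \<le> l" "1 \<le> i" "i < j" "j \<le> int n - l + 1" for i j l
  proof
    assume "substring x i l = substring x j l"
    then have "take m (substring x i l) = take m (substring x j l)" by simp
    then have "take m (drop (nat (i - 1)) x) = take m (drop (nat (j - 1)) x)"
      using that by (simp add: substring_def min_def le_nat_iff split: if_splits)
    then show False using rm[of "nat (i - 1)" "nat (j - 1)"] that by linarith
  qed
  have uniq: "substring x i l \<noteq> substring x j l"
    if "int m \<le> l" "1 \<le> i" "i \<le> int n - l + 1" "1 \<le> j" "j \<le> int n - l + 1" "i \<noteq> j" for i j l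
    using less[of l i j] less[of l j i] that by (cases "i < j") auto
  \<comment> \<open>The first bound in \<open>sep\<close> places all of \<open>I3\<close> to the
    right of \<open>t + 1\<close>, so \<open>i < j\<close> here.\<close>
  have last: "substring x i (ell3 L t) \<noteq> substring x j (ell3 L t)"
    if "i \<in> {1..t + 1}" "j \<in> I3 n L t" for i j
    using rr[of "nat (i - 1)" "nat (j - 1)"] that sep pos
    by (simp add: substring_def I3_def) linarith
  show ?thesis
    unfolding LREC_def substring_unique_def len
  proof (intro conjI ballI impI)
    \<comment> \<open>The second bound in \<open>sep\<close> keeps \<open>{1..t + 1}\<close>, and
      below also \<open>I2\<close>, within the valid starting positions.\<close>
    fix i j assume ij: "i \<in> {1..t + 1}" "j \<in> {1..int n - ell2 L t + 1}" "i \<noteq> j"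
    then show "substring x i (ell2 L t) \<noteq> substring x j (ell2 L t)"
      using uniq[of "ell2 L t" i j] pos sep ij by auto
  next
    fix i j assume ij: "i \<in> {1..int n - ell2 L t + 1}" "j \<in> I2 n L t" "i \<noteq> j"
    then show "substring x i (ell2 L t) \<noteq> substring x j (ell2 L t)"
      using uniq[of "ell2 L t" i j] pos sep ij by (auto simp: I2_def)
  qed (use uniq pos last in auto)
qed

text \<open>With growth rate \<open>2 powr s\<close>, a repeat length of at least
  \<open>c * lg\<close> has weight of order \<open>n powr (- s * c)\<close>, so the weight condition
  becomes a condition on powers of \<open>n\<close>.\<close>

lemma D_ge_powr:
  fixes s c1 c2 lg :: real
  assumes s: "0 < s" "s < 1" and n: "0 < n" and lg: "lg = log 2 (real n)"
    and c: "0 < c1 * lg" "0 < c2 * lg"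
    and ell: "c1 * lg \<le> ell1 L t" "c1 * lg \<le> ell2 L t" "c2 * lg \<le> ell3 L t"
    and sep: "ell3 L t + 2 * t < int n" "ell2 L t + t \<le> int n"
    and T: "real (nat (t + 1)) \<le> T"
    and wt: "2 * real n powr (1 - s * c1) + 2 * T * real n powr (- s * c2) \<le> 2 - 2 powr s"
  shows "2 powr (s * real n) \<le> real (D n L t)"
proof -
  define m r where "m = nat (min (ell1 L t) (ell2 L t))" and "r = nat (ell3 L t)"
  have m: "int m = min (ell1 L t) (ell2 L t)" "c1 * lg \<le> real m" "0 < m"
    using ell c by (auto simp: m_def min_def)
  have r: "int r = ell3 L t" "c2 * lg \<le> real r" "0 < r"
    using ell c by (auto simp: r_def)
  \<comment> \<open>The factor 2 absorbs the \<open>2 powr s\<close> that comes from the exponent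
    \<open>k - 1\<close>.\<close>
  have wt1: "1 / (2 powr s) ^ (k - 1) \<le> 2 * real n powr (- s * c)"
    if "c * lg \<le> real k" "0 < k" for k c
  proof -
    have "1 / (2 powr s) ^ (k - 1) = 2 powr (s - s * real k)"
      using that by (simp add: powr_realpow[symmetric] powr_powr powr_minus_divide[symmetric] of_nat_diff algebra_simps)
    also have "\<dots> \<le> 2 powr (1 + log 2 (real n) * (- s * c))"
    proof -
      have "s * (c * lg) \<le> s * real k" using that s by simp
      moreover have "lg * (- s * c) = - (s * (c * lg))" by simp
      ultimately have "s - s * real k \<le> 1 + lg * (- s * c)" using s by linarith
      then show ?thesis by (simp add: lg)
    qed
    also have "\<dots> = 2 * real n powr (- s * c)"
      using n by (simp only: powr_add powr_powr[symmetric]) simp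
    finally show ?thesis .
  qed
  have "real n / (2 powr s) ^ (m - 1) \<le> real n * (2 * real n powr (- s * c1))"
    using mult_left_mono[OF wt1[OF m(2,3)], of "real n"] by simp
  also have "\<dots> = 2 * real n powr (1 - s * c1)"
    using n by (simp add: powr_diff powr_minus_divide)
  finally have w1: "real n / (2 powr s) ^ (m - 1) \<le> 2 * real n powr (1 - s * c1)" .
  have "real (nat (t + 1)) / (2 powr s) ^ (r - 1) \<le> T * (2 * real n powr (- s * c2))"
    using mult_mono[OF T wt1[OF r(2,3)]] T by simp
  then have "real n / (2 powr s) ^ (m - 1) + real (nat (t + 1)) / (2 powr s) ^ (r - 1) \<le> 2 - 2 powr s"
    using w1 wt by (simp add: algebra_simps)
  from repeat_free_count[OF m(3) r(3) _ this]
  have "(2 powr s) ^ n \<le> real (card {x :: bool list. length x = n \<and>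
    (\<forall>i j. i < j \<and> j + m \<le> n \<longrightarrow> take m (drop i x) \<noteq> take m (drop j x)) \<and>
    (\<forall>i j. i < j \<and> i < nat (t + 1) \<and> j + r \<le> n \<longrightarrow> take r (drop i x) \<noteq> take r (drop j x))})"
    (is "_ \<le> real (card ?A)") by simp
  also have "card ?A \<le> D n L t"
    unfolding D_def
  proof (rule card_mono)
    show "finite (LREC_set n L t)"
      by (rule finite_subset[OF _ finite_lists_length_eq[of UNIV n]]) (auto simp: LREC_set_def)
    show "?A \<subseteq> LREC_set n L t"
      using LREC_if_repeat_free[of m L t n] m r sep by (auto simp: LREC_set_def r_def)
  qed
  finally show ?thesis by (simp add: powr_realpow[symmetric] powr_powr)
qed

section \<open>Upper bound and the limit\<close>

lemma D_le: "D n L t \<le> 2 ^ n"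
proof -
  have "D n L t \<le> card {x :: bool list. set x \<subseteq> UNIV \<and> length x = n}"
    unfolding D_def by (rule card_mono[OF finite_lists_length_eq]) (auto simp: LREC_set_def)
  then show ?thesis using card_lists_length_eq[of "UNIV :: bool set" n] by simp
qed

theorem theorem12:
  fixes b :: nat and a :: real and t L :: "nat \<Rightarrow> int"
  assumes "(\<lambda>n. real_of_int (t n) - real b * log 2 (real n)) \<in> o(\<lambda>n. log 2 (real n))"
    and "\<And>n. L n = \<lceil>a * log 2 (real n)\<rceil> + \<lfloor>real_of_int (t n) / 3\<rfloor> + 1"
    and "a > max (real b / 3 + 1) (2 * real b / 3)"
  shows "(\<lambda>n. log 2 (real (D n (L n) (t n))) / real n) \<longlonglongrightarrow> 1"
proof -
  text \<open>Half the slack in the hypothesis on \<open>a\<close>; the other half absorbs the rounding and the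
    \<open>o(log n)\<close> term of \<open>t\<close>.\<close>
  define \<eta> where "\<eta> = min (a - real b / 3 - 1) (a - 2 * real b / 3) / 2"
  have eta: "0 < \<eta>" "1 + 2 * \<eta> \<le> a - real b / 3" "2 * \<eta> \<le> a - 2 * real b / 3"
    using assms(3) by (auto simp: \<eta>_def min_def max_def split: if_splits)
  define lg where "lg = (\<lambda>n. log 2 (real n))"
  have dev: "eventually (\<lambda>n. \<bar>real_of_int (t n) - real b * lg n\<bar> \<le> \<eta> / 2 * \<bar>lg n\<bar>) sequentially"
    using landau_o.smallD[OF assms(1), of "\<eta> / 2"] eta by (simp add: lg_def)
  \<comment> \<open>The bound \<open>3 / \<eta>\<close> makes \<open>\<eta> * lg n\<close> at least
    3, enough to pay for all floors and ceilings.\<close>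
  have large: "eventually (\<lambda>n. lg n \<ge> max 1 (3 / \<eta>)) sequentially"
    unfolding lg_def by real_asymp
  have room: "eventually (\<lambda>n. (a + 2 * (real b + \<eta>)) * lg n + 2 < real n) sequentially"
    unfolding lg_def by real_asymp
  have bound: "eventually (\<lambda>n. 2 powr (s * real n) \<le> real (D n (L n) (t n))) sequentially"
    if s: "0 < s" "s < 1" "1 < s * (1 + \<eta>)" for s
  proof -
    \<comment> \<open>Since \<open>1 < s * (1 + \<eta>)\<close>, the first exponent is negative; in
      the second term a negative power of \<open>n\<close> beats the logarithm.\<close>
    have "((\<lambda>n. 2 * real n powr (1 - s * (1 + \<eta>)) +
        2 * ((real b + \<eta>) * lg n + 1) * real n powr (- s * \<eta>)) \<longlongrightarrow> 0) sequentially"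
    proof -
      define p q K where "p = s * (1 + \<eta>) - 1" and "q = s * \<eta>" and "K = real b + \<eta>"
      have "0 < p" "0 < q" "0 < K" using s eta by (auto simp: p_def q_def K_def)
      then have "(\<lambda>n. 2 * real n powr (- p)) \<longlonglongrightarrow> 0"
        "(\<lambda>n. 2 * (K * log 2 (real n) + 1) * real n powr (- q)) \<longlonglongrightarrow> 0"
        by real_asymp+
      from tendsto_add_zero[OF this] show ?thesis by (simp add: p_def q_def K_def lg_def)
    qed
    moreover have "0 < 2 - 2 powr s" using powr_less_mono[of s 1 2] s by simp
    ultimately have wt: "eventually (\<lambda>n. 2 * real n powr (1 - s * (1 + \<eta>)) +
        2 * ((real b + \<eta>) * lg n + 1) * real n powr (- s * \<eta>) < 2 - 2 powr s) sequentially"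
      by (rule order_tendstoD(2))
    show ?thesis
      using dev large room wt eventually_gt_at_top[of 0]
    proof eventually_elim
      case (elim n)
      define u where "u = real_of_int (t n)"
      have lg: "1 \<le> lg n" "3 \<le> \<eta> * lg n"
        using elim(2) eta by (auto simp: field_simps)
      have u: "u \<le> real b * lg n + \<eta> * lg n / 2"
        using elim(1) lg by (simp add: u_def abs_if split: if_splits)
      have prods: "lg n + 2 * (\<eta> * lg n) \<le> a * lg n - real b * lg n / 3"
        "2 * (\<eta> * lg n) \<le> a * lg n - 2 * (real b * lg n) / 3"
        using mult_right_mono[OF eta(2), of "lg n"] mult_right_mono[OF eta(3), of "lg n"] lg
        by (simp_all add: algebra_simps)
      have b0: "0 \<le> real b * lg n" using lg by simp
      have Ln: "L n = \<lceil>a * lg n\<rceil> + \<lfloor>u / 3\<rfloor> + 1" by (simp add: assms(2) u_def lg_def)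
      have l1: "ell1 (L n) (t n) = \<lceil>a * lg n\<rceil>"
        and l2: "ell2 (L n) (t n) = \<lceil>a * lg n\<rceil> + \<lfloor>u / 3\<rfloor> - \<lceil>2 * u / 3\<rceil>"
        and l3: "ell3 (L n) (t n) = \<lceil>a * lg n\<rceil> + \<lfloor>u / 3\<rfloor> - t n"
        by (simp_all add: ell1_def ell2_def ell3_def Ln u_def)
      have fl: "a * lg n \<le> \<lceil>a * lg n\<rceil>" "\<lceil>a * lg n\<rceil> \<le> a * lg n + 1"
        "u / 3 - 1 \<le> \<lfloor>u / 3\<rfloor>" "\<lfloor>u / 3\<rfloor> \<le> u / 3"
        "2 * u / 3 \<le> \<lceil>2 * u / 3\<rceil>" "\<lceil>2 * u / 3\<rceil> \<le> 2 * u / 3 + 1"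
        by linarith+
      \<comment> \<open>Up to rounding, \<open>ell2\<close> is \<open>a * lg n - u / 3\<close> and
        \<open>ell3\<close> is \<open>a * lg n - 2 * u / 3\<close>. These yield the two terms of the
        maximum in the hypothesis on \<open>a\<close>: about \<open>n\<close> competing positions
        demand length above \<open>lg n\<close>, whereas the \<open>O(log n)\<close> positions tied
        to \<open>ell3\<close> only demand a positive multiple of \<open>lg n\<close>.\<close>
      have e1: "(1 + \<eta>) * lg n \<le> ell1 (L n) (t n)"
        unfolding l1 distrib_right using fl(1) prods(1) b0 lg by linarith
      have e2: "(1 + \<eta>) * lg n \<le> ell2 (L n) (t n)"
        unfolding l2 of_int_add of_int_diff distrib_right using fl prods u lg by linarith
      have e3: "\<eta> * lg n \<le> ell3 (L n) (t n)"
        unfolding l3 of_int_add of_int_diff u_def[symmetric] using fl prods u lg by linarith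
      have room: "a * lg n + 2 * (real b * lg n) + 2 * (\<eta> * lg n) + 2 < real n"
        using elim(3) by (simp add: algebra_simps)
      have "real_of_int (ell3 (L n) (t n) + 2 * t n) < real_of_int (int n)"
        unfolding l3 of_int_add of_int_diff of_int_mult of_int_numeral of_int_of_nat_eq u_def[symmetric]
        using fl u room b0 lg by linarith
      then have s3: "ell3 (L n) (t n) + 2 * t n < int n" by linarith
      have "real_of_int (ell2 (L n) (t n) + t n) \<le> real_of_int (int n)"
        unfolding l2 of_int_add of_int_diff of_int_mult of_int_numeral of_int_of_nat_eq u_def[symmetric]
        using fl u room b0 lg by linarith
      then have s2: "ell2 (L n) (t n) + t n \<le> int n" by linarith
      \<comment> \<open>For \<open>b = 0\<close> the value \<open>t n\<close> may be negative;
        \<open>nat\<close> then gives 0.\<close>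
      have T: "real (nat (t n + 1)) \<le> (real b + \<eta>) * lg n + 1"
        using u b0 lg by (cases "t n + 1 \<ge> 0") (auto simp: algebra_simps u_def)
      show ?case
        by (rule D_ge_powr[OF s(1,2) elim(5), where lg = "lg n" and ?c1.0 = "1 + \<eta>" and ?c2.0 = \<eta>,
              OF _ _ _ e1 e2 e3 s3 s2 T]) (use elim(4) lg eta in \<open>auto simp: lg_def\<close>)
    qed
  qed
  show ?thesis
  proof (rule order_tendstoI)
    fix y :: real assume "y < 1"
    have q: "0 < 1 / (1 + \<eta>)" "1 / (1 + \<eta>) < 1" using eta by simp_all
    \<comment> \<open>Exceeding \<open>y\<close> gives the wanted bound, and exceeding
      \<open>1 / (1 + \<eta>)\<close> makes \<open>bound\<close> applicable.\<close>
    obtain s where "max y (1 / (1 + \<eta>)) < s" "s < 1"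
      using dense[of "max y (1 / (1 + \<eta>))" 1] \<open>y < 1\<close> q by auto
    then have s: "0 < s" "s < 1" "1 / (1 + \<eta>) < s" "y < s"
      using less_trans[OF q(1), of s] by simp_all
    then have "1 < s * (1 + \<eta>)" using eta by (simp add: field_simps)
    from bound[OF s(1,2) this] eventually_gt_at_top[of 0]
    show "eventually (\<lambda>n. y < log 2 (real (D n (L n) (t n))) / real n) sequentially"
    proof eventually_elim
      case (elim n)
      have "0 < (2 :: real) powr (s * real n)" by simp
      then have "0 < real (D n (L n) (t n))" using elim(1) by linarith
      then have "s * real n \<le> log 2 (real (D n (L n) (t n)))"
        using elim(1) by (simp add: le_log_iff)
      then show ?case using s(4) elim(2) by (simp add: field_simps) (meson less_le_trans mult_strict_right_mono of_nat_0_less_iff)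
    qed
  next
    fix y :: real assume "1 < y"
    show "eventually (\<lambda>n. log 2 (real (D n (L n) (t n))) / real n < y) sequentially"
      using eventually_gt_at_top[of 0]
    proof eventually_elim
      case (elim n)
      have "log 2 (real (D n (L n) (t n))) \<le> real n"
      \<comment> \<open>If the count is 0, the logarithm takes its default value 0.\<close>
      proof (cases "D n (L n) (t n) = 0")
        case False
        have "real (D n (L n) (t n)) \<le> 2 ^ n"
          using of_nat_mono[OF D_le[of n "L n" "t n"], where 'a = real] by simp
        then show ?thesis using False by (simp add: log_le_iff powr_realpow)
      qed (simp add: log_def)
      then have "log 2 (real (D n (L n) (t n))) / real n \<le> 1" using elim by simp
      then show ?case using \<open>1 < y\<close> by linarith
    qed
  qed
qed

end
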